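(* For every $n\ge1$, $$RB(12/3,1/24/3)\sim LS(1/23,13/2/4)\quad\text{and}\quad RS(12/3,1/24/3)\sim LB(1/23,13/2/4).$$ That is, for every integer $k$: the number of $w\in R_n(12/3,1/24/3)$ with $rb(w)=k$ equals the number of $w\in R_n(1/23,13/2/4)$ with $ls(w)=k$; and the number of $w\in R_n(12/3,1/24/3)$ with $rs(w)=k$ equals the number of $w\in R_n(1/23,13/2/4)$ with $lb(w)=k$.
   Context: A set partition $\sigma$ of $[n]=\{1,\dots,n\}$ is written $\sigma=B_1/B_2/\dots/B_m$ with blocks ordered so that $\min B_1<\dots<\min B_m$. For $A\subseteq[n]$, the subpartition $A\cap\sigma$ is the set partition of $A$ formed by the nonempty sets $A\cap B_i$; it is standardized by replacing its smallest element by $1$, the next smallest by $2$, and so on. $\sigma$ contains a pattern $\pi$ (a set partition of some $[k]$) if some subpartition of $\sigma$ standardizes to $\pi$; otherwise $\sigma$ avoids $\pi$. To $\sigma=B_1/\dots/B_m$ corresponds the word (restricted growth function) $w(\sigma)=w_1\cdots w_n$ with $w_i=j$ if $i\in B_j$. $R_n(\pi_1,\pi_2)$ is the set of words $w(\sigma)$ for set partitions $\sigma$ of $[n]$ avoiding both $\pi_1$ and $\pi_2$. Wachs and White statistics: for a word $w=w_1\cdots w_n$ and position $i$, let (counting distinct letter values) $rs_i(w)=|\{w_j: j>i,\ w_j<w_i\}|$, $ls_i(w)=|\{w_j: j<i,\ w_j<w_i\}|$, $lb_i(w)=|\{w_j: j<i,\ w_j>w_i\}|$, $rb_i(w)=|\{w_j: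 j>i,\ w_j>w_i\}|$; and $rs(w)=\sum_i rs_i(w)$, $ls(w)=\sum_i ls_i(w)$, $lb(w)=\sum_i lb_i(w)$, $rb(w)=\sum_i rb_i(w)$. Patterns: slashes separate blocks, e.g. $1/24/3$ is the set partition $\{1\},\{2,4\},\{3\}$ of $[4]$ and $12/3$ is $\{1,2\},\{3\}$ of $[3]$. *)

theory Defs
  imports "HOL-Library.Disjoint_Sets"
begin

text \<open>A set partition of $[n]$ is a set of blocks \<open>\<sigma>\<close> with \<open>partition_on {1..n} \<sigma>\<close>.\<close>

definition subpartition :: "nat set \<Rightarrow> nat set set \<Rightarrow> nat set set" where
  "subpartition A \<sigma> = (\<lambda>B. A \<inter> B) ` \<sigma> - {{}}"

text \<open>The \<open>i\<close>-th smallest element \<open>x\<close> of the underlying set \<open>\<Union>\<sigma>\<close> is replaced by its rank \<open>i\<close>.\<close>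

definition standardize :: "nat set set \<Rightarrow> nat set set" where
  "standardize \<sigma> = (\<lambda>B. (\<lambda>x. card {y \<in> \<Union>\<sigma>. y \<le> x}) ` B) ` \<sigma>"

definition contains_pattern :: "nat set set \<Rightarrow> nat set set \<Rightarrow> bool" where
  "contains_pattern \<sigma> \<pi> \<longleftrightarrow> (\<exists>A \<subseteq> \<Union>\<sigma>. standardize (subpartition A \<sigma>) = \<pi>)"

abbreviation avoids_pattern :: "nat set set \<Rightarrow> nat set set \<Rightarrow> bool" where
  "avoids_pattern \<sigma> \<pi> \<equiv> \<not> contains_pattern \<sigma> \<pi>"

text \<open>The list $B_1, \dots, B_m$ of blocks with $\min B_1 < \dots < \min B_m$.\<close>

definition ordered_blocks :: "nat set set \<Rightarrow> nat set list" where
  "ordered_blocks \<sigma> = (THE bs. set bs = \<sigma> \<and> sorted_wrt (\<lambda>B C. Min B < Min C) bs)"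

text \<open>
  Words are lists, so the letter at position \<open>i \<in> {1..n}\<close> has list index \<open>i - 1\<close>,
  and $B_j$ is \<open>ordered_blocks \<sigma> ! (j - 1)\<close>. Letters are the block numbers $1, \dots, m$.
\<close>

definition rgf_word :: "nat \<Rightarrow> nat set set \<Rightarrow> nat list" where
  "rgf_word n \<sigma> =
     map (\<lambda>i. THE j. j \<in> {1..length (ordered_blocks \<sigma>)} \<and> i \<in> ordered_blocks \<sigma> ! (j - 1))
       [1..<Suc n]"

definition R :: "nat \<Rightarrow> nat set set \<Rightarrow> nat set set \<Rightarrow> nat list set" where
  "R n \<pi>\<^sub>1 \<pi>\<^sub>2 =
     rgf_word n ` {\<sigma>. partition_on {1..n} \<sigma> \<and> avoids_pattern \<sigma> \<pi>\<^sub>1 \<and> avoids_pattern \<sigma> \<pi>\<^sub>2}"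

text \<open>
  The Wachs--White statistics. Each inner set consists of letter values, so repeated letters are
  counted once.
\<close>

definition rs :: "nat list \<Rightarrow> nat" where
  "rs w = (\<Sum>i<length w. card {w ! j |j. i < j \<and> j < length w \<and> w ! j < w ! i})"

definition ls :: "nat list \<Rightarrow> nat" where
  "ls w = (\<Sum>i<length w. card {w ! j |j. j < i \<and> w ! j < w ! i})"

definition lb :: "nat list \<Rightarrow> nat" where
  "lb w = (\<Sum>i<length w. card {w ! j |j. j < i \<and> w ! j > w ! i})"

definition rb :: "nat list \<Rightarrow> nat" where
  "rb w = (\<Sum>i<length w. card {w ! j |j. i < j \<and> j < length w \<and> w ! j > w ! i})"

end

theory Submission
  imports Defs
begin

text \<open>
  A word avoiding \<open>12/3\<close> is constant from its first repeated letter on, and avoiding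
  \<open>1/24/3\<close> forces this constant to be the smallest or the largest letter. So the first class
  consists of $12\cdots m\,m^{n-m}$ ($1 \le m \le n$) and $12\cdots m\,1^{n-m}$
  ($2 \le m < n$). Dually, avoiding \<open>1/23\<close> only lets the letter $1$ repeat, with at most one $1$
  after the initial run, and avoiding \<open>13/2/4\<close> puts that $1$ at the end: the second class
  consists of $1^{n-m}\,12\cdots m$ and $1^{n-m}\,2\cdots m\,1$ with the same ranges of $m$.
  On both classes \<open>(rb, rs)\<close>, respectively \<open>(ls, lb)\<close>, equals $({m \choose 2}, 0)$ on the
  first kind of words and $({m \choose 2}, m - 1)$ on the second. These values determine the
  word, so the obvious bijection matches both statistics at once.
\<close>

section \<open>Pattern containment as embedding\<close>

text \<open>Partitions are handled through this equivalence relation, so that equality and pattern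
  containment become statements about pairs of elements.\<close>

definition same_block :: "'a set set \<Rightarrow> 'a \<Rightarrow> 'a \<Rightarrow> bool" where
  "same_block P x y \<longleftrightarrow> (\<exists>B\<in>P. x \<in> B \<and> y \<in> B)"

lemma partition_on_block_eq:
  assumes "partition_on A P" "B \<in> P" "x \<in> B"
  shows "B = {y \<in> A. same_block P x y}"
proof -
  have *: "C = B" if "C \<in> P" "x \<in> C" for C
    using assms that unfolding partition_on_def disjoint_def by blast
  have "B \<subseteq> A" using assms unfolding partition_on_def by blast
  then show ?thesis using * assms unfolding same_block_def by blast
qed

lemma partition_on_subset_same_block:
  assumes P: "partition_on A P" and Q: "partition_on A Q"
    and same: "\<And>x y. x \<in> A \<Longrightarrow> y \<in> A \<Longrightarrow> same_block P x y \<longleftrightarrow> same_block Q x y"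
  shows "P \<subseteq> Q"
proof
  fix B assume B: "B \<in> P"
  then obtain x where x: "x \<in> B" using P unfolding partition_on_def by (metis ex_in_conv)
  then have xA: "x \<in> A" using B P unfolding partition_on_def by blast
  then obtain C where C: "C \<in> Q" "x \<in> C" using Q unfolding partition_on_def by blast
  have "B = C"
    using partition_on_block_eq[OF P B x] partition_on_block_eq[OF Q C] same xA by blast
  then show "B \<in> Q" using C by simp
qed

lemma partition_on_eqI:
  assumes "partition_on A P" "partition_on A Q"
    and "\<And>x y. x \<in> A \<Longrightarrow> y \<in> A \<Longrightarrow> same_block P x y \<longleftrightarrow> same_block Q x y"
  shows "P = Q"
  using partition_on_subset_same_block[of A P Q] partition_on_subset_same_block[of A Q P] assms
  by (meson subset_antisym)

lemma partition_on_subpartition: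
  assumes "partition_on S \<sigma>" "A \<subseteq> S"
  shows "partition_on A (subpartition A \<sigma>)"
  using partition_on_restrict[OF assms(1), of A] assms(2)
  by (simp add: subpartition_def inf.absorb1)

lemma same_block_subpartition:
  assumes "x \<in> A" "y \<in> A"
  shows "same_block (subpartition A \<sigma>) x y \<longleftrightarrow> same_block \<sigma> x y"
  using assms unfolding same_block_def subpartition_def by blast

text \<open>The relabelling inside \<open>standardize\<close>, with the ground set as an explicit
  argument.\<close>

definition rank :: "nat set \<Rightarrow> nat \<Rightarrow> nat" where
  "rank A x = card {y \<in> A. y \<le> x}"

lemma strict_mono_on_rank:
  assumes "finite A"
  shows "strict_mono_on A (rank A)"
proof (rule strict_mono_onI)
  fix x y assume "x \<in> A" "y \<in> A" "x < y"
  then have "{z \<in> A. z \<le> x} \<subset> {z \<in> A. z \<le> y}" by force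
  then show "rank A x < rank A y"
    unfolding rank_def using assms by (intro psubset_card_mono) auto
qed

text \<open>The elements of the image up to \<open>f a\<close> are those of \<open>f\<close> on
  \<open>{1..a}\<close>; thus \<open>rank\<close> inverts an increasing enumeration.\<close>

lemma rank_image_strict_mono:
  assumes f: "strict_mono_on {1..k} f" and a: "a \<in> {1..k}"
  shows "rank (f ` {1..k}) (f a) = a"
proof -
  have "{y \<in> f ` {1..k}. y \<le> f a} = f ` {1..a}"
    using a by (auto simp: strict_mono_on_less_eq[OF f])
  moreover have "inj_on f {1..a}"
    by (rule inj_on_subset[OF strict_mono_on_imp_inj_on[OF f]]) (use a in auto)
  ultimately show ?thesis by (simp add: rank_def card_image)
qed

lemma standardize_eq_rank:
  assumes "partition_on A \<tau>"
  shows "standardize \<tau> = (`) (rank A) ` \<tau>"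
  using assms by (simp add: standardize_def rank_def partition_on_def)

lemma partition_on_standardize:
  assumes "finite A" "partition_on A \<tau>"
  shows "partition_on (rank A ` A) (standardize \<tau>)"
proof -
  have "inj_on (rank A) A"
    using strict_mono_on_rank[OF assms(1)] by (rule strict_mono_on_imp_inj_on)
  from partition_on_inj_image[OF assms(2) this]
  have "partition_on (rank A ` A) ((`) (rank A) ` \<tau> - {{}})" .
  moreover have "(`) (rank A) ` \<tau> - {{}} = (`) (rank A) ` \<tau>"
    using assms(2) unfolding partition_on_def by blast
  ultimately show ?thesis using assms(2) by (simp add: standardize_eq_rank)
qed

lemma same_block_standardize:
  assumes "finite A" "partition_on A \<tau>" "x \<in> A" "y \<in> A"
  shows "same_block (standardize \<tau>) (rank A x) (rank A y) \<longleftrightarrow> same_block \<tau> x y"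
proof -
  have inj: "inj_on (rank A) A"
    using strict_mono_on_rank[OF assms(1)] by (rule strict_mono_on_imp_inj_on)
  have "rank A z \<in> rank A ` B \<longleftrightarrow> z \<in> B" if "B \<in> \<tau>" "z \<in> A" for B z
  proof -
    have "B \<subseteq> A" using assms(2) that(1) unfolding partition_on_def by blast
    then show ?thesis using inj that(2) by (simp add: inj_on_image_mem_iff)
  qed
  then show ?thesis
    using assms unfolding same_block_def standardize_eq_rank[OF assms(2)] by blast
qed

text \<open>The set \<open>A\<close> and the embedding \<open>f\<close> determine each other:
  \<open>A\<close> is the image of \<open>f\<close>, and \<open>f\<close> is the inverse of
  \<open>rank A\<close>.\<close>

lemma contains_pattern_iff_embedding:
  assumes \<sigma>: "partition_on {1..n} \<sigma>" and \<pi>: "partition_on {1..k} \<pi>"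
  shows "contains_pattern \<sigma> \<pi> \<longleftrightarrow>
    (\<exists>f. strict_mono_on {1..k} f \<and> f ` {1..k} \<subseteq> {1..n} \<and>
      (\<forall>a\<in>{1..k}. \<forall>b\<in>{1..k}. same_block \<sigma> (f a) (f b) \<longleftrightarrow> same_block \<pi> a b))"
    (is "_ \<longleftrightarrow> (\<exists>f. ?emb f)")
proof
  assume "contains_pattern \<sigma> \<pi>"
  then obtain A where A: "A \<subseteq> {1..n}" and std: "standardize (subpartition A \<sigma>) = \<pi>"
    using \<sigma> unfolding contains_pattern_def partition_on_def by auto
  have fin: "finite A" using A finite_subset by blast
  have sub: "partition_on A (subpartition A \<sigma>)"
    using partition_on_subpartition[OF \<sigma> A] .
  \<comment> \<open>Equal partitions have equal ground sets.\<close>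
  have img: "rank A ` A = {1..k}"
    using partition_on_standardize[OF fin sub] \<pi> std unfolding partition_on_def by simp
  define f where "f = inv_into A (rank A)"
  have fA: "f a \<in> A" "rank A (f a) = a" if "a \<in> {1..k}" for a
    using that img unfolding f_def by (metis inv_into_into, metis f_inv_into_f)
  have "strict_mono_on {1..k} f"
  proof (rule strict_mono_onI)
    fix a b assume ab: "a \<in> {1..k}" "b \<in> {1..k}" "a < b"
    show "f a < f b"
    proof (rule ccontr)
      assume "\<not> f a < f b"
      then have "rank A (f b) \<le> rank A (f a)"
        by (intro strict_mono_on_leD[OF strict_mono_on_rank[OF fin]] fA ab) simp
      then show False using fA ab by simp
    qed
  qed
  moreover have "same_block \<sigma> (f a) (f b) \<longleftrightarrow> same_block \<pi> a b"
    if "a \<in> {1..k}" "b \<in> {1..k}" for a b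
    using same_block_standardize[OF fin sub, of "f a" "f b"] fA[OF that(1)] fA[OF that(2)] std
    by (simp add: same_block_subpartition)
  ultimately have "?emb f" using fA A by blast
  then show "\<exists>f. ?emb f" by (intro exI[of _ f])
next
  assume "\<exists>f. ?emb f"
  then obtain f where emb: "?emb f" by (elim exE)
  then have f: "strict_mono_on {1..k} f" "f ` {1..k} \<subseteq> {1..n}" by simp_all
  define A where "A = f ` {1..k}"
  have fin: "finite A" unfolding A_def by simp
  have sub: "partition_on A (subpartition A \<sigma>)"
    using partition_on_subpartition[OF \<sigma>] f(2) unfolding A_def .
  have rank: "rank A (f a) = a" if "a \<in> {1..k}" for a
    unfolding A_def by (rule rank_image_strict_mono[OF f(1) that])
  then have img: "rank A ` A = {1..k}" unfolding A_def by force
  have "standardize (subpartition A \<sigma>) = \<pi>"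
  proof (rule partition_on_eqI)
    show "partition_on {1..k} (standardize (subpartition A \<sigma>))"
      using partition_on_standardize[OF fin sub] img by simp
    fix a b assume ab: "a \<in> {1..k}" "b \<in> {1..k}"
    then have "f a \<in> A" "f b \<in> A" unfolding A_def by auto
    then show "same_block (standardize (subpartition A \<sigma>)) a b \<longleftrightarrow> same_block \<pi> a b"
      using same_block_standardize[OF fin sub, of "f a" "f b"] rank ab emb
      by (simp add: same_block_subpartition)
  qed (rule \<pi>)
  moreover have "\<Union>\<sigma> = {1..n}" using \<sigma> unfolding partition_on_def by simp
  ultimately show "contains_pattern \<sigma> \<pi>"
    using f(2) unfolding contains_pattern_def A_def by blast
qed

section \<open>Restricted growth functions\<close>

text \<open>Equivalent to the usual bound by one more than the maximum so far; this form directly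
  supplies an earlier position for every smaller positive letter.\<close>

definition rgf :: "nat list \<Rightarrow> bool" where
  "rgf w \<longleftrightarrow> (\<forall>i<length w. 1 \<le> w ! i \<and> (\<forall>v\<in>{1..<w ! i}. \<exists>j<i. w ! j = v))"

text \<open>Only the equality pattern of the letters is tied to \<open>\<sigma>\<close>; for a
  restricted growth function it fixes their values too. \<open>Suc\<close> turns list indices into
  elements of the ground set.\<close>

definition encodes :: "nat list \<Rightarrow> nat set set \<Rightarrow> bool" where
  "encodes w \<sigma> \<longleftrightarrow>
    (\<forall>i<length w. \<forall>j<length w. w ! i = w ! j \<longleftrightarrow> same_block \<sigma> (Suc i) (Suc j))"

text \<open>Resolves the \<open>THE\<close>: the strictly sorted lists of minima agree, and
  \<open>Min\<close> is injective on the blocks.\<close>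

lemma ordered_blocks_eqI:
  assumes set: "set bs = \<sigma>" and sorted: "sorted_wrt (\<lambda>B C. Min B < Min C) bs"
  shows "ordered_blocks \<sigma> = bs"
  unfolding ordered_blocks_def
proof (rule the_equality)
  fix cs assume cs: "set cs = \<sigma> \<and> sorted_wrt (\<lambda>B C. Min B < Min C) cs"
  have "sorted_wrt (<) (map Min bs)" "sorted_wrt (<) (map Min cs)"
    using sorted cs by (simp_all add: sorted_wrt_map)
  then have "map Min cs = map Min bs"
    by (rule strict_sorted_equal) (use set cs in auto)
  moreover have "inj_on Min \<sigma>"
    using \<open>sorted_wrt (<) (map Min bs)\<close> set
    by (metis distinct_map strict_sorted_iff)
  ultimately show "cs = bs" using set cs by (simp add: map_inj_on)
qed (use assms in simp)

text \<open>Disjoint nonempty blocks have distinct minima, so sorting the minima and pulling back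
  along \<open>Min\<close> orders the blocks.\<close>

lemma obtain_sorted_blocks:
  assumes "partition_on A \<sigma>" "finite A"
  obtains bs :: "nat set list"
  where "set bs = \<sigma>" "sorted_wrt (\<lambda>B C. Min B < Min C) bs"
proof -
  have mem: "Min B \<in> B" if "B \<in> \<sigma>" for B
  proof (rule Min_in)
    show "finite B" "B \<noteq> {}"
      using assms that unfolding partition_on_def by (auto intro: finite_subset)
  qed
  have inj: "inj_on Min \<sigma>"
  proof (rule inj_onI)
    fix B C assume "B \<in> \<sigma>" "C \<in> \<sigma>" "Min B = Min C"
    then show "B = C"
      using mem[of B] mem[of C] assms(1) unfolding partition_on_def disjoint_def by auto
  qed
  have fin: "finite (Min ` \<sigma>)" using finite_elements[OF assms(2,1)] by simp
  define ms where "ms = sorted_list_of_set (Min ` \<sigma>)"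
  define bs where "bs = map (inv_into \<sigma> Min) ms"
  have ms: "set ms = Min ` \<sigma>" "sorted_wrt (<) ms" using fin unfolding ms_def by simp_all
  have Min_bs: "map Min bs = ms"
    unfolding bs_def map_map using ms(1) by (intro map_idI) (auto simp: f_inv_into_f)
  have "set bs = \<sigma>" unfolding bs_def using ms(1) inj by (force simp: image_image)
  moreover have "sorted_wrt (\<lambda>B C. Min B < Min C) bs"
    using ms(2) unfolding Min_bs[symmetric] sorted_wrt_map .
  ultimately show ?thesis by (rule that)
qed

lemma rgf_word_encodes:
  assumes \<sigma>: "partition_on {1..n} \<sigma>"
  shows "length (rgf_word n \<sigma>) = n" "rgf (rgf_word n \<sigma>)" "encodes (rgf_word n \<sigma>) \<sigma>"
proof -
  obtain bs where bs: "set bs = \<sigma>" "sorted_wrt (\<lambda>B C. Min B < Min C) bs"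
    using obtain_sorted_blocks[OF \<sigma>] by blast
  have ob: "ordered_blocks \<sigma> = bs" using bs by (rule ordered_blocks_eqI)
  let ?w = "rgf_word n \<sigma>"
  show len: "length ?w = n" by (simp add: rgf_word_def)
  have block: "bs ! a \<in> \<sigma>" "Min (bs ! a) \<in> bs ! a" "bs ! a \<subseteq> {1..n}" "finite (bs ! a)"
    if "a < length bs" for a
  proof -
    show *: "bs ! a \<in> \<sigma>" using that bs(1) by auto
    show **: "bs ! a \<subseteq> {1..n}" using * \<sigma> unfolding partition_on_def by blast
    then show ***: "finite (bs ! a)" using finite_subset by blast
    show "Min (bs ! a) \<in> bs ! a" using * *** \<sigma> unfolding partition_on_def by (metis Min_in)
  qed
  have uniq: "a = b" if ab: "a < length bs" "b < length bs" "x \<in> bs ! a" "x \<in> bs ! b" for a b x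
  proof -
    have "bs ! a = bs ! b"
      using partition_on_block_eq[OF \<sigma> block(1)] ab by metis
    then have "\<not> Min (bs ! a) < Min (bs ! b)" "\<not> Min (bs ! b) < Min (bs ! a)" by simp_all
    then show ?thesis using ab(1,2) bs(2) by (metis linorder_neqE_nat sorted_wrt_nth_less)
  qed
  have letter_eq: "?w ! i = Suc a" if "i < n" "a < length bs" "Suc i \<in> bs ! a" for i a
  proof -
    have "?w ! i = (THE j. j \<in> {1..length bs} \<and> Suc i \<in> bs ! (j - 1))"
      using that(1) by (simp add: rgf_word_def ob del: upt_Suc)
    also have "\<dots> = Suc a"
    proof (rule the_equality)
      fix j assume "j \<in> {1..length bs} \<and> Suc i \<in> bs ! (j - 1)"
      then show "j = Suc a" using uniq[of "j - 1" a "Suc i"] that by auto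
    qed (use that in auto)
    finally show ?thesis .
  qed
  have ex: "\<exists>a<length bs. Suc i \<in> bs ! a \<and> ?w ! i = Suc a" if "i < n" for i
  proof -
    have "Suc i \<in> \<Union>\<sigma>" using that \<sigma> unfolding partition_on_def by auto
    then obtain a where "a < length bs" "Suc i \<in> bs ! a"
      using bs(1) by (metis UnionE in_set_conv_nth)
    then show ?thesis using letter_eq[OF that] by blast
  qed
  show "rgf ?w"
    unfolding rgf_def len
  proof (intro allI impI conjI ballI)
    fix i assume "i < n"
    then obtain a where a: "a < length bs" "Suc i \<in> bs ! a" "?w ! i = Suc a" using ex by blast
    show "1 \<le> ?w ! i" using a by simp
    fix v assume "v \<in> {1..<?w ! i}"
    then have v: "v - 1 < a" "Suc (v - 1) = v" using a by auto
    \<comment> \<open>The block numbered \<open>v\<close> precedes that of \<open>Suc i\<close>, so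
      its minimum lies before \<open>Suc i\<close> and marks an earlier occurrence of
      \<open>v\<close>.\<close>
    define m where "m = Min (bs ! (v - 1))"
    have vl: "v - 1 < length bs" using v a by simp
    have "m < Min (bs ! a)"
      unfolding m_def using sorted_wrt_nth_less[OF bs(2) v(1) a(1)] .
    also have "\<dots> \<le> Suc i" using block[OF a(1)] a(2) by simp
    finally have m: "m < Suc i" .
    have "m \<in> bs ! (v - 1)" "m \<ge> 1" using block[OF vl] unfolding m_def by auto
    then have "m - 1 < i" "?w ! (m - 1) = v"
      using letter_eq[of "m - 1" "v - 1"] vl m \<open>i < n\<close> v by auto
    then show "\<exists>j<i. ?w ! j = v" by blast
  qed
  show "encodes ?w \<sigma>"
    unfolding encodes_def len
  proof (intro allI impI)
    fix i j assume ij: "i < n" "j < n"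
    obtain a b where a: "a < length bs" "Suc i \<in> bs ! a" "?w ! i = Suc a"
      and b: "b < length bs" "Suc j \<in> bs ! b" "?w ! j = Suc b"
      using ex ij by metis
    show "?w ! i = ?w ! j \<longleftrightarrow> same_block \<sigma> (Suc i) (Suc j)"
    proof
      assume "?w ! i = ?w ! j"
      then show "same_block \<sigma> (Suc i) (Suc j)"
        using a b block(1) unfolding same_block_def by auto
    next
      assume "same_block \<sigma> (Suc i) (Suc j)"
      then have "Suc j \<in> bs ! a"
        using partition_on_block_eq[OF \<sigma> block(1)[OF a(1)] a(2)] ij by auto
      then show "?w ! i = ?w ! j" using uniq a b by metis
    qed
  qed
qed

text \<open>At a first disagreement, the smaller of the two letters occurs earlier in the word
  carrying the larger one, hence at the same place in both words, and there the equality patterns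
  differ.\<close>

lemma rgf_eqI:
  assumes w: "rgf w" and u: "rgf u" and len: "length w = length u"
    and same: "\<And>i j. i < length w \<Longrightarrow> j < length w \<Longrightarrow> w ! i = w ! j \<longleftrightarrow> u ! i = u ! j"
  shows "w = u"
proof -
  have "w ! i = u ! i" if "i < length w" for i
    using that
  proof (induction i rule: less_induct)
    case (less i)
    have ge: "1 \<le> w ! i" "1 \<le> u ! i" using w u less.prems len unfolding rgf_def by auto
    have "\<not> w ! i < u ! i"
    proof
      assume lt: "w ! i < u ! i"
      then have "w ! i \<in> {1..<u ! i}" using ge by simp
      then obtain j where j: "j < i" "u ! j = w ! i"
        using u less.prems unfolding rgf_def len by blast
      then have "w ! j = w ! i" using less by simp
      then show False using same[of j i] j less.prems lt by simp
    qed
    moreover have "\<not> u ! i < w ! i"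
    proof
      assume lt: "u ! i < w ! i"
      then have "u ! i \<in> {1..<w ! i}" using ge by simp
      then obtain j where j: "j < i" "w ! j = u ! i"
        using w less.prems unfolding rgf_def by blast
      then have "u ! j = u ! i" using less by simp
      then show False using same[of j i] j less.prems lt by simp
    qed
    ultimately show ?case by simp
  qed
  then show ?thesis using len by (simp add: list_eq_iff_nth_eq)
qed

text \<open>The blocks are the level sets of the word, shifted by one. With \<open>rgf_eqI\<close>
  this shows that every restricted growth function is the word of a partition.\<close>

lemma obtain_encoded_partition:
  obtains \<sigma> where "partition_on {1..length w} \<sigma>" "encodes w \<sigma>"
proof -
  define \<sigma> where "\<sigma> = (\<lambda>i. {x \<in> {1..length w}. w ! (x - 1) = w ! i}) ` {..<length w}"
  have "partition_on {1..length w} \<sigma>"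
  proof (rule partition_onI)
    show "\<Union>\<sigma> = {1..length w}"
    proof
      show "{1..length w} \<subseteq> \<Union>\<sigma>"
      proof
        fix x assume "x \<in> {1..length w}"
        then show "x \<in> \<Union>\<sigma>" unfolding \<sigma>_def by (intro UN_I[of "x - 1"]) auto
      qed
    qed (auto simp: \<sigma>_def)
    show "{} \<notin> \<sigma>"
    proof
      assume "{} \<in> \<sigma>"
      then obtain i where "i < length w" "{x \<in> {1..length w}. w ! (x - 1) = w ! i} = {}"
        unfolding \<sigma>_def by auto
      moreover have "Suc i \<in> {x \<in> {1..length w}. w ! (x - 1) = w ! i}" using calculation by simp
      ultimately show False by blast
    qed
  qed (auto simp: \<sigma>_def disjnt_def)
  moreover have "encodes w \<sigma>"
    unfolding encodes_def same_block_def \<sigma>_def by auto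
  ultimately show ?thesis by (rule that)
qed

section \<open>Pattern occurrences in words\<close>

definition word_contains :: "nat list \<Rightarrow> nat \<Rightarrow> nat set set \<Rightarrow> bool" where
  "word_contains w k \<pi> \<longleftrightarrow>
    (\<exists>f. strict_mono_on {1..k} f \<and> f ` {1..k} \<subseteq> {..<length w} \<and>
      (\<forall>a\<in>{1..k}. \<forall>b\<in>{1..k}. w ! f a = w ! f b \<longleftrightarrow> same_block \<pi> a b))"

text \<open>The embeddings on the two sides differ by the shift between elements, counted from
  \<open>1\<close>, and list indices, counted from \<open>0\<close>.\<close>

lemma contains_pattern_iff_word_contains:
  assumes \<sigma>: "partition_on {1..length w} \<sigma>" and \<pi>: "partition_on {1..k} \<pi>" and w: "encodes w \<sigma>"
  shows "contains_pattern \<sigma> \<pi> \<longleftrightarrow> word_contains w k \<pi>"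
  unfolding contains_pattern_iff_embedding[OF \<sigma> \<pi>] word_contains_def
proof (intro iffI; elim exE conjE)
  fix f assume f: "strict_mono_on {1..k} f" "f ` {1..k} \<subseteq> {1..length w}"
    and same: "\<forall>a\<in>{1..k}. \<forall>b\<in>{1..k}. same_block \<sigma> (f a) (f b) \<longleftrightarrow> same_block \<pi> a b"
  have range: "f a - 1 < length w" "Suc (f a - 1) = f a" if "a \<in> {1..k}" for a
    using f(2) that by (force, force)
  have "strict_mono_on {1..k} (\<lambda>a. f a - 1)"
  proof (rule strict_mono_onI)
    fix a b assume ab: "a \<in> {1..k}" "b \<in> {1..k}" "a < b"
    then have "f a < f b" using f(1) by (auto simp: strict_mono_on_def)
    then show "f a - 1 < f b - 1" using range[OF ab(1)] by linarith
  qed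
  moreover have "(\<lambda>a. f a - 1) ` {1..k} \<subseteq> {..<length w}" using range by auto
  moreover have "w ! (f a - 1) = w ! (f b - 1) \<longleftrightarrow> same_block \<pi> a b"
    if "a \<in> {1..k}" "b \<in> {1..k}" for a b
    using w range[OF that(1)] range[OF that(2)] same that unfolding encodes_def by metis
  ultimately show "\<exists>f. strict_mono_on {1..k} f \<and> f ` {1..k} \<subseteq> {..<length w} \<and>
      (\<forall>a\<in>{1..k}. \<forall>b\<in>{1..k}. w ! f a = w ! f b \<longleftrightarrow> same_block \<pi> a b)" by blast
next
  fix f assume f: "strict_mono_on {1..k} f" "f ` {1..k} \<subseteq> {..<length w}"
    and same: "\<forall>a\<in>{1..k}. \<forall>b\<in>{1..k}. w ! f a = w ! f b \<longleftrightarrow> same_block \<pi> a b"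
  have "strict_mono_on {1..k} (\<lambda>a. Suc (f a))" using f(1) by (simp add: strict_mono_on_def)
  moreover have "(\<lambda>a. Suc (f a)) ` {1..k} \<subseteq> {1..length w}" using f(2) by fastforce
  moreover have "same_block \<sigma> (Suc (f a)) (Suc (f b)) \<longleftrightarrow> same_block \<pi> a b"
    if "a \<in> {1..k}" "b \<in> {1..k}" for a b
  proof -
    have "f a < length w" "f b < length w" using f(2) that by blast+
    then show ?thesis using w same that unfolding encodes_def by blast
  qed
  ultimately show "\<exists>f. strict_mono_on {1..k} f \<and> f ` {1..k} \<subseteq> {1..length w} \<and>
      (\<forall>a\<in>{1..k}. \<forall>b\<in>{1..k}. same_block \<sigma> (f a) (f b) \<longleftrightarrow> same_block \<pi> a b)" by blast
qed

text \<open>Eliminates set partitions: a restricted growth function equals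
  \<open>rgf_word n \<sigma>\<close> for the partition it encodes, because both have the same
  equality pattern.\<close>

lemma R_eq:
  assumes "partition_on {1..k} \<pi>" "partition_on {1..l} \<rho>"
  shows "R n \<pi> \<rho> = {w. length w = n \<and> rgf w \<and> \<not> word_contains w k \<pi> \<and> \<not> word_contains w l \<rho>}"
    (is "_ = ?W")
proof
  show "R n \<pi> \<rho> \<subseteq> ?W"
  proof
    fix w assume "w \<in> R n \<pi> \<rho>"
    then obtain \<sigma> where \<sigma>: "partition_on {1..n} \<sigma>" "avoids_pattern \<sigma> \<pi>" "avoids_pattern \<sigma> \<rho>"
      and w: "w = rgf_word n \<sigma>" unfolding R_def by blast
    note enc = rgf_word_encodes[OF \<sigma>(1), folded w]
    then show "w \<in> ?W"
      using \<sigma> assms contains_pattern_iff_word_contains[of w \<sigma>] by auto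
  qed
  show "?W \<subseteq> R n \<pi> \<rho>"
  proof
    fix w assume w: "w \<in> ?W"
    then obtain \<sigma> where \<sigma>: "partition_on {1..n} \<sigma>" "encodes w \<sigma>"
      using obtain_encoded_partition[of w] by auto
    note enc = rgf_word_encodes[OF \<sigma>(1)]
    have "w = rgf_word n \<sigma>"
    proof (rule rgf_eqI)
      show "rgf w" using w by simp
      show "length w = length (rgf_word n \<sigma>)" using w enc by simp
      fix i j assume "i < length w" "j < length w"
      then show "w ! i = w ! j \<longleftrightarrow> rgf_word n \<sigma> ! i = rgf_word n \<sigma> ! j"
        using \<sigma>(2) enc w unfolding encodes_def by simp
    qed (rule enc)
    moreover have "avoids_pattern \<sigma> \<pi>" "avoids_pattern \<sigma> \<rho>"
      using w \<sigma> assms contains_pattern_iff_word_contains[of w \<sigma>] by auto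
    ultimately show "w \<in> R n \<pi> \<rho>" using \<sigma>(1) unfolding R_def by blast
  qed
qed

section \<open>Explicit form of the four patterns\<close>

lemma atLeastAtMost_1_3: "{1..3} = {1, 2, 3::nat}"
  and atLeastAtMost_1_4: "{1..4} = {1, 2, 3, 4::nat}"
  by auto

text \<open>An embedding of \<open>{1..3}\<close> is an increasing triple. Looking up positions in
  \<open>[i, j, k]\<close> keeps the condition a finite check that simplification settles for a
  concrete pattern.\<close>

lemma word_contains_3_iff:
  "word_contains w 3 \<pi> \<longleftrightarrow>
    (\<exists>i j k. i < j \<and> j < k \<and> k < length w \<and>
      (\<forall>a\<in>{1, 2, 3}. \<forall>b\<in>{1, 2, 3}.
        w ! ([i, j, k] ! (a - 1)) = w ! ([i, j, k] ! (b - 1)) \<longleftrightarrow> same_block \<pi> a b))"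
    (is "_ \<longleftrightarrow> ?R")
proof
  assume "word_contains w 3 \<pi>"
  then obtain f where f: "strict_mono_on {1, 2, 3} f" "f ` {1, 2, 3} \<subseteq> {..<length w}"
    "\<forall>a\<in>{1, 2, 3}. \<forall>b\<in>{1, 2, 3}. w ! f a = w ! f b \<longleftrightarrow> same_block \<pi> a b"
    unfolding word_contains_def atLeastAtMost_1_3 by (elim exE conjE)
  have "f 1 < f 2" "f 2 < f 3"
    using f(1) by (auto simp: strict_mono_on_def)
  moreover have "f 3 < length w" using f(2) by simp
  ultimately show ?R
    using f(3)
    by (intro exI[of _ "f 1"] exI[of _ "f 2"] exI[of _ "f 3"]) simp
next
  assume ?R
  then obtain i j k where *: "i < j" "j < k" "k < length w"
    "\<forall>a\<in>{1, 2, 3}. \<forall>b\<in>{1, 2, 3}.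
      w ! ([i, j, k] ! (a - 1)) = w ! ([i, j, k] ! (b - 1)) \<longleftrightarrow> same_block \<pi> a b" by (elim exE conjE)
  have "strict_mono_on {1, 2, 3} (\<lambda>a. [i, j, k] ! (a - 1))"
    using *(1,2,3) by (auto simp: strict_mono_on_def)
  moreover have "(\<lambda>a. [i, j, k] ! (a - 1)) ` {1, 2, 3} \<subseteq> {..<length w}"
    using *(1,2,3) by auto
  ultimately show "word_contains w 3 \<pi>"
    unfolding word_contains_def atLeastAtMost_1_3 using *(4)
    by (intro exI[of _ "\<lambda>a. [i, j, k] ! (a - 1)"] conjI)
qed

lemma word_contains_4_iff:
  "word_contains w 4 \<pi> \<longleftrightarrow>
    (\<exists>i j k l. i < j \<and> j < k \<and> k < l \<and> l < length w \<and>
      (\<forall>a\<in>{1, 2, 3, 4}. \<forall>b\<in>{1, 2, 3, 4}.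
        w ! ([i, j, k, l] ! (a - 1)) = w ! ([i, j, k, l] ! (b - 1)) \<longleftrightarrow> same_block \<pi> a b))"
    (is "_ \<longleftrightarrow> ?R")
proof
  assume "word_contains w 4 \<pi>"
  then obtain f where f: "strict_mono_on {1, 2, 3, 4} f" "f ` {1, 2, 3, 4} \<subseteq> {..<length w}"
    "\<forall>a\<in>{1, 2, 3, 4}. \<forall>b\<in>{1, 2, 3, 4}. w ! f a = w ! f b \<longleftrightarrow> same_block \<pi> a b"
    unfolding word_contains_def atLeastAtMost_1_4 by (elim exE conjE)
  have "f 1 < f 2" "f 2 < f 3" "f 3 < f 4"
    using f(1) by (auto simp: strict_mono_on_def)
  moreover have "f 4 < length w" using f(2) by simp
  ultimately show ?R
    using f(3)
    by (intro exI[of _ "f 1"] exI[of _ "f 2"] exI[of _ "f 3"] exI[of _ "f 4"]) simp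
next
  assume ?R
  then obtain i j k l where *: "i < j" "j < k" "k < l" "l < length w"
    "\<forall>a\<in>{1, 2, 3, 4}. \<forall>b\<in>{1, 2, 3, 4}.
      w ! ([i, j, k, l] ! (a - 1)) = w ! ([i, j, k, l] ! (b - 1)) \<longleftrightarrow> same_block \<pi> a b" by (elim exE conjE)
  have "strict_mono_on {1, 2, 3, 4} (\<lambda>a. [i, j, k, l] ! (a - 1))"
    using *(1,2,3,4) by (auto simp: strict_mono_on_def)
  moreover have "(\<lambda>a. [i, j, k, l] ! (a - 1)) ` {1, 2, 3, 4} \<subseteq> {..<length w}"
    using *(1,2,3,4) by auto
  ultimately show "word_contains w 4 \<pi>"
    unfolding word_contains_def atLeastAtMost_1_4 using *(5)
    by (intro exI[of _ "\<lambda>a. [i, j, k, l] ! (a - 1)"] conjI)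
qed

lemma word_contains_12_3:
  "word_contains w 3 {{1,2},{3}} \<longleftrightarrow>
    (\<exists>i j k. i < j \<and> j < k \<and> k < length w \<and> w ! i = w ! j \<and> w ! j \<noteq> w ! k)"
  unfolding word_contains_3_iff
  by (intro arg_cong[where f = Ex] ext) (auto simp: same_block_def)

lemma word_contains_1_23:
  "word_contains w 3 {{1},{2,3}} \<longleftrightarrow>
    (\<exists>i j k. i < j \<and> j < k \<and> k < length w \<and> w ! i \<noteq> w ! j \<and> w ! j = w ! k)"
  unfolding word_contains_3_iff
  by (intro arg_cong[where f = Ex] ext) (auto simp: same_block_def)

lemma word_contains_1_24_3:
  "word_contains w 4 {{1},{2,4},{3}} \<longleftrightarrow>
    (\<exists>i j k l. i < j \<and> j < k \<and> k < l \<and> l < length w \<and>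
      w ! i \<noteq> w ! j \<and> w ! i \<noteq> w ! k \<and> w ! j \<noteq> w ! k \<and> w ! j = w ! l)"
  unfolding word_contains_4_iff
  by (intro arg_cong[where f = Ex] ext) (auto simp: same_block_def)

lemma word_contains_13_2_4:
  "word_contains w 4 {{1,3},{2},{4}} \<longleftrightarrow>
    (\<exists>i j k l. i < j \<and> j < k \<and> k < l \<and> l < length w \<and>
      w ! i \<noteq> w ! j \<and> w ! i = w ! k \<and> w ! i \<noteq> w ! l \<and> w ! j \<noteq> w ! l)"
  unfolding word_contains_4_iff
  by (intro arg_cong[where f = Ex] ext) (auto simp: same_block_def)

section \<open>The two classes\<close>

text \<open>In \<open>(m, b)\<close>, the largest letter is \<open>m\<close>; the word ends in \<open>m\<close> if \<open>b\<close> and in \<open>1\<close> otherwise.\<close>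

definition indices :: "nat \<Rightarrow> (nat \<times> bool) set" where
  "indices n = {1..n} \<times> {True} \<union> {2..<n} \<times> {False}"

text \<open>Both flags give the same word for \<open>m = 1\<close> and for \<open>m = n\<close>, so
  \<open>indices\<close> admits \<open>False\<close> only for \<open>2 <= m < n\<close>.\<close>

fun tail_word :: "nat \<Rightarrow> nat \<times> bool \<Rightarrow> nat list" where
  "tail_word n (m, b) = map (\<lambda>i. if i < m then Suc i else if b then m else 1) [0..<n]"

text \<open>On \<open>indices n\<close>, the flag \<open>True\<close> puts \<open>n - m\<close> ones
  before the run \<open>1\<close> to \<open>m\<close>, while \<open>False\<close> puts them before
  the run \<open>2\<close> to \<open>m\<close> and adds a last \<open>1\<close>, whence the
  different offsets.\<close>

fun head_word :: "nat \<Rightarrow> nat \<times> bool \<Rightarrow> nat list" where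
  "head_word n (m, True) = map (\<lambda>i. if i < n - m then 1 else Suc i - (n - m)) [0..<n]"
| "head_word n (m, False) =
    map (\<lambda>i. if i < n - m \<or> Suc i = n then 1 else i + 2 - (n - m)) [0..<n]"

text \<open>The first \<open>m\<close> letters are distinct and the rest is constant, so nothing new
  follows a repetition. In \<open>1/24/3\<close> the repeated letter would be \<open>m\<close>,
  after which no other letter comes, or the initial \<open>1\<close>, before which there is
  none.\<close>

lemma tail_word_avoids:
  assumes "x \<in> indices n"
  shows "length (tail_word n x) = n" "rgf (tail_word n x)"
    "\<not> word_contains (tail_word n x) 3 {{1,2},{3}}"
    "\<not> word_contains (tail_word n x) 4 {{1},{2,4},{3}}"
proof -
  obtain m b where x: "x = (m, b)" by force
  have m: "1 \<le> m" "m \<le> n" using assms unfolding x indices_def by auto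
  show "length (tail_word n x) = n" by (simp add: x)
  show "rgf (tail_word n x)"
    unfolding rgf_def
  proof (intro allI impI conjI ballI)
    fix i assume i: "i < length (tail_word n x)"
    show "1 \<le> tail_word n x ! i" using i m by (simp add: x)
    fix v assume "v \<in> {1..<tail_word n x ! i}"
    then have "v - 1 < i" "tail_word n x ! (v - 1) = v"
      using i m by (auto simp: x simp del: upt_Suc split: if_splits)
    then show "\<exists>j<i. tail_word n x ! j = v" by blast
  qed
  show "\<not> word_contains (tail_word n x) 3 {{1,2},{3}}"
    unfolding word_contains_12_3 by (auto simp: x simp del: upt_Suc split: if_splits)
  show "\<not> word_contains (tail_word n x) 4 {{1},{2,4},{3}}"
    unfolding word_contains_1_24_3 by (auto simp: x simp del: upt_Suc split: if_splits)
qed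

text \<open>Only \<open>1\<close> repeats, and after another letter it returns at most once, in last
  position. So \<open>1/23\<close> lacks a second later \<open>1\<close>, and \<open>13/2/4\<close>
  lacks a letter after the return.\<close>

lemma head_word_avoids:
  assumes "x \<in> indices n"
  shows "length (head_word n x) = n" "rgf (head_word n x)"
    "\<not> word_contains (head_word n x) 3 {{1},{2,3}}"
    "\<not> word_contains (head_word n x) 4 {{1,3},{2},{4}}"
proof -
  consider (T) m where "x = (m, True)" "1 \<le> m" "m \<le> n"
    | (F) m where "x = (m, False)" "2 \<le> m" "m < n"
    using assms unfolding indices_def by auto
  note cases = this
  show len: "length (head_word n x) = n" by (cases rule: cases) simp_all
  show "rgf (head_word n x)"
    unfolding rgf_def len
  proof (intro allI impI conjI ballI)
    fix i assume i: "i < n"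
    show "1 \<le> head_word n x ! i" using i by (cases rule: cases) auto
    fix v assume v: "v \<in> {1..<head_word n x ! i}"
    show "\<exists>j<i. head_word n x ! j = v"
    proof (cases rule: cases)
      case T
      then show ?thesis
        \<comment> \<open>The witness solves \<open>Suc j - (n - m) = v\<close> for the index
          \<open>j\<close> in the rising run.\<close>
        using v i by (intro exI[of _ "v + (n - m) - 1"]) (auto simp del: upt_Suc split: if_splits)
    next
      case F
      show ?thesis
      \<comment> \<open>Here the rising run starts at \<open>2\<close>, so the letter
        \<open>1\<close> is found at index \<open>0\<close>.\<close>
      proof (cases "v = 1")
        case True
        then show ?thesis using F v i by (intro exI[of _ 0]) (auto simp del: upt_Suc split: if_splits)
      next
        case False
        then show ?thesis
          using F v i by (intro exI[of _ "v + (n - m) - 2"]) (auto simp del: upt_Suc split: if_splits)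
      qed
    qed
  qed
  show "\<not> word_contains (head_word n x) 3 {{1},{2,3}}"
    unfolding word_contains_1_23 by (cases rule: cases) (auto simp del: upt_Suc split: if_splits)
  show "\<not> word_contains (head_word n x) 4 {{1,3},{2},{4}}"
    unfolding word_contains_13_2_4 by (cases rule: cases) (auto simp del: upt_Suc split: if_splits)
qed

section \<open>Every avoiding word belongs to its family\<close>

lemma rgf_le_if_prefix_le:
  assumes "rgf w" "i < length w" "\<And>j. j < i \<Longrightarrow> w ! j \<le> b"
  shows "w ! i \<le> Suc b"
proof (rule ccontr)
  assume "\<not> w ! i \<le> Suc b"
  then have "Suc b \<in> {1..<w ! i}" by simp
  then show False using assms unfolding rgf_def by force
qed

text \<open>Growth bounds the letter by \<open>Suc i\<close>, and the letters \<open>1\<close> to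
  \<open>i\<close> are already taken by the earlier positions.\<close>

lemma rgf_eq_Suc_if_distinct:
  assumes w: "rgf w" and d: "distinct (take m w)" and "i < m" "i < length w"
  shows "w ! i = Suc i"
  using assms(3,4)
proof (induction i rule: less_induct)
  case (less i)
  then have IH: "w ! j = Suc j" if "j < i" for j using that by simp
  have "w ! i \<le> Suc i" using rgf_le_if_prefix_le[OF w less.prems(2), of i] IH by simp
  moreover have "1 \<le> w ! i" using w less.prems unfolding rgf_def by blast
  moreover have "w ! i \<noteq> w ! j" if "j < i" for j
    using that d less.prems nth_eq_iff_index_eq[OF d, of i j] by simp
  then have "w ! i \<noteq> Suc j" if "j < i" for j using IH that by metis
  from this[of "w ! i - 1"] have "\<not> w ! i - 1 < i" using \<open>1 \<le> w ! i\<close> by auto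
  ultimately show ?case by simp
qed

lemma mem_tail_word_image:
  assumes n: "n \<ge> 1" and len: "length w = n" and w: "rgf w"
    and no12_3: "\<not> word_contains w 3 {{1,2},{3}}"
    and no1_24_3: "\<not> word_contains w 4 {{1},{2,4},{3}}"
  shows "w \<in> tail_word n ` indices n"
proof (cases "distinct w")
  case True
  then have "w = tail_word n (n, True)"
    using rgf_eq_Suc_if_distinct[OF w, of n] len by (simp add: list_eq_iff_nth_eq)
  moreover have "(n, True) \<in> indices n" using n unfolding indices_def by simp
  ultimately show ?thesis by blast
next
  case False
  \<comment> \<open>\<open>m\<close> is the list index of the first letter that repeats an earlier
    one; the prefix of length \<open>m\<close> is still distinct.\<close>
  define m where "m = (LEAST m. \<not> distinct (take (Suc m) w))"
  have ex: "\<not> distinct (take (Suc n) w)" using False len by simp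
  have m: "\<not> distinct (take (Suc m) w)" unfolding m_def by (rule LeastI, rule ex)
  have d: "distinct (take m w)"
  proof (cases m)
    case (Suc k)
    then show ?thesis using not_less_Least[of k "\<lambda>m. \<not> distinct (take (Suc m) w)"] m_def by auto
  qed simp
  have mn: "m < n" using m d len by (metis take_all_iff not_less le_SucI)
  have start: "w ! i = Suc i" if "i < m" for i
    using rgf_eq_Suc_if_distinct[OF w d that] that mn len by simp
  have "w ! m \<in> set (take m w)"
    using m d mn len by (simp add: take_Suc_conv_app_nth)
  then obtain p where p: "p < m" "w ! m = w ! p"
    using mn len by (auto simp: in_set_conv_nth)
  have tail: "w ! i = Suc p" if "m \<le> i" "i < n" for i
  proof (rule ccontr)
    assume "w ! i \<noteq> Suc p"
    moreover have "w ! m = Suc p" using p start by simp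
    ultimately have "m < i" "w ! m \<noteq> w ! i" using that(1) by (auto simp: le_less)
    then have "word_contains w 3 {{1,2},{3}}"
      unfolding word_contains_12_3 using p that(2) len by metis
    then show False using no12_3 by contradiction
  qed
  \<comment> \<open>For \<open>m = 1\<close> the smallest and the largest letter coincide and the
    flag is \<open>True\<close>; the case \<open>p = 0\<close>, \<open>2 <= m\<close> yields
    \<open>False\<close>.\<close>
  consider "p = 0" "m = 1" | "p = 0" "2 \<le> m" | "Suc p = m" | "0 < p" "Suc p < m"
    using p(1) by linarith
  then have "(m, Suc p = m) \<in> indices n \<and> w = tail_word n (m, Suc p = m)"
  proof cases
    case 4
    \<comment> \<open>Indices \<open>0\<close>, \<open>p\<close>, \<open>m - 1\<close>,
      \<open>m\<close> carry the letters \<open>1\<close>, \<open>Suc p\<close>, \<open>m\<close>,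
      \<open>Suc p\<close>.\<close>
    have "word_contains w 4 {{1},{2,4},{3}}"
      unfolding word_contains_1_24_3
      by (rule exI[of _ 0], rule exI[of _ p], rule exI[of _ "m - 1"], rule exI[of _ m])
        (use 4 p start mn len in auto)
    then show ?thesis using no1_24_3 by blast
  qed (use start tail mn len in \<open>auto simp: indices_def list_eq_iff_nth_eq\<close>)
  then show ?thesis by blast
qed

text \<open>Let \<open>l\<close> be the length of the initial run of ones. Avoiding
  \<open>1/23\<close> makes the letters from \<open>l\<close> on distinct, avoiding
  \<open>13/2/4\<close> delays a further \<open>1\<close> to the end, and growth makes the others
  consecutive from \<open>2\<close>. For a nonconstant word the last letter decides the
  flag.\<close>

lemma mem_head_word_image:
  assumes n: "n \<ge> 1" and len: "length w = n" and w: "rgf w"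
    and no1_23: "\<not> word_contains w 3 {{1},{2,3}}"
    and no13_2_4: "\<not> word_contains w 4 {{1,3},{2},{4}}"
  shows "w \<in> head_word n ` indices n"
proof -
  have w0: "w ! 0 = 1" using w n len unfolding rgf_def
    by (metis atLeastLessThan_iff le_neq_implies_less less_nat_zero_code order_refl
        less_le_trans zero_less_one)
  \<comment> \<open>The alternative \<open>l = n\<close> covers the constant word.\<close>
  define l where "l = (LEAST l. l = n \<or> w ! l \<noteq> 1)"
  have l: "l = n \<or> w ! l \<noteq> 1" unfolding l_def by (rule LeastI[of _ n]) simp
  have "l \<le> n" unfolding l_def by (rule Least_le) simp
  have start: "w ! i = 1" if "i < l" for i using not_less_Least that unfolding l_def by blast
  have "0 < l" using l w0 n by (cases l) auto
  show ?thesis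
  proof (cases "l = n")
    case True
    then have "w = head_word n (1, True)"
      using start len by (auto simp: list_eq_iff_nth_eq)
    moreover have "(1, True) \<in> indices n" using n unfolding indices_def by simp
    ultimately show ?thesis by blast
  next
    case False
    then have ln: "l < n" "w ! l \<noteq> 1" using \<open>l \<le> n\<close> l by auto
    have distinct: "w ! i \<noteq> w ! j" if "l \<le> i" "i < j" "j < n" for i j
    proof
      assume eq: "w ! i = w ! j"
      \<comment> \<open>The letter repeated at \<open>i\<close> and \<open>j\<close> would fill all
        positions before \<open>i\<close>, against \<open>w ! 0 = 1\<close> and
        \<open>w ! l \<noteq> 1\<close>.\<close>
      have "w ! a = w ! i" if "a < i" for a
        using no1_23 that eq \<open>i < j\<close> \<open>j < n\<close> len unfolding word_contains_1_23 by blast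
      from this[of 0] this[of l] show False
        using w0 ln that \<open>0 < l\<close> by (cases "l = i") auto
    qed
    have no1: "w ! i \<noteq> 1" if "l \<le> i" "Suc i < n" for i
    proof
      assume i: "w ! i = 1"
      have "l < i" using i ln that by (cases "l = i") auto
      have "word_contains w 4 {{1,3},{2},{4}}"
        unfolding word_contains_13_2_4
        by (rule exI[of _ 0], rule exI[of _ l], rule exI[of _ i], rule exI[of _ "Suc i"])
          (use \<open>0 < l\<close> \<open>l < i\<close> that i w0 ln len distinct[of i "Suc i"] distinct[of l "Suc i"]
            in auto)
      then show False using no13_2_4 by blast
    qed
    have rise: "w ! i = i + 2 - l" if "l \<le> i" "i < n" "w ! i \<noteq> 1" for i
      using that
    proof (induction i rule: less_induct)
      case (less i)
      have IH: "w ! j = j + 2 - l" if "l \<le> j" "j < i" for j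
        using less no1[of j] that by simp
      have "w ! j \<le> i + 1 - l" if "j < i" for j
        using IH[of j] start[of j] that less.prems by (cases "j < l") auto
      then have "w ! i \<le> i + 2 - l"
        using rgf_le_if_prefix_le[OF w, of i "i + 1 - l"] less.prems len by simp
      moreover have "2 \<le> w ! i" using w less.prems len unfolding rgf_def
        by (metis One_nat_def Suc_1 Suc_leI le_neq_implies_less)
      \<comment> \<open>By the induction hypothesis a smaller letter already sits at index
        \<open>w ! i + l - 2\<close>, against distinctness.\<close>
      moreover have "\<not> w ! i < i + 2 - l"
      proof
        assume "w ! i < i + 2 - l"
        then have "l \<le> w ! i + l - 2" "w ! i + l - 2 < i" using \<open>2 \<le> w ! i\<close> by auto
        then show False
          using IH[of "w ! i + l - 2"] distinct[of "w ! i + l - 2" i] less.prems \<open>2 \<le> w ! i\<close>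
          by auto
      qed
      ultimately show ?case by simp
    qed
    show ?thesis
    proof (cases "w ! (n - 1) = 1")
      case True
      then have "l < n - 1" using ln by (cases "l = n - 1") auto
      \<comment> \<open>The \<open>l\<close> ones, the letters \<open>2\<close> to \<open>m\<close>
        and the last \<open>1\<close> fill length \<open>n\<close>, so
        \<open>m = n - l\<close>.\<close>
      moreover have "w = head_word n (n - l, False)"
      proof (rule nth_equalityI)
        show "length w = length (head_word n (n - l, False))" using len by simp
        fix i assume "i < length w"
        moreover have "Suc i = n \<Longrightarrow> w ! i = 1" using True by auto
        ultimately show "w ! i = head_word n (n - l, False) ! i"
          using start[of i] no1[of i] rise[of i] len ln
          by (cases "Suc i = n") (auto simp del: upt_Suc)
      qed
      moreover have "(n - l, False) \<in> indices n"
        using \<open>0 < l\<close> \<open>l < n - 1\<close> unfolding indices_def by auto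
      ultimately show ?thesis by blast
    next
      case False
      \<comment> \<open>Without a returning \<open>1\<close> the count is
        \<open>l + (m - 1) = n\<close>.\<close>
      have "w = head_word n (Suc n - l, True)"
      proof (rule nth_equalityI)
        show "length w = length (head_word n (Suc n - l, True))" using len by simp
        fix i assume i: "i < length w"
        have "i = n - 1 \<or> Suc i < n" using i len by linarith
        then have "l \<le> i \<Longrightarrow> w ! i \<noteq> 1" using False no1[of i] by auto
        then show "w ! i = head_word n (Suc n - l, True) ! i"
          using start[of i] rise[of i] len ln i \<open>0 < l\<close> by (cases "i < l") auto
      qed
      moreover have "(Suc n - l, True) \<in> indices n"
        using \<open>0 < l\<close> ln unfolding indices_def by auto
      ultimately show ?thesis by blast
    qed
  qed
qed

section \<open>The statistics\<close>

text \<open>All positive letters below \<open>w ! i\<close> have occurred before, and each value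
  counts once.\<close>

lemma ls_rgf:
  assumes "rgf w"
  shows "ls w = (\<Sum>i<length w. w ! i - 1)"
  unfolding ls_def
proof (rule sum.cong)
  fix i assume "i \<in> {..<length w}"
  then have i: "i < length w" by simp
  have "{w ! j |j. j < i \<and> w ! j < w ! i} = {1..<w ! i}"
  proof
    show "{w ! j |j. j < i \<and> w ! j < w ! i} \<subseteq> {1..<w ! i}"
      using assms i unfolding rgf_def by auto
    show "{1..<w ! i} \<subseteq> {w ! j |j. j < i \<and> w ! j < w ! i}"
    proof
      fix v assume v: "v \<in> {1..<w ! i}"
      then obtain j where "j < i" "w ! j = v" using assms i unfolding rgf_def by blast
      then show "v \<in> {w ! j |j. j < i \<and> w ! j < w ! i}" using v by auto
    qed
  qed
  then show "card {w ! j |j. j < i \<and> w ! j < w ! i} = w ! i - 1" by simp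
qed simp

text \<open>Ones contribute nothing, wherever they stand, and the letters \<open>2\<close> to
  \<open>m\<close> contribute \<open>1\<close> to \<open>m - 1\<close>.\<close>

lemma ls_head_word:
  assumes "(m, b) \<in> indices n"
  shows "ls (head_word n (m, b)) = \<Sum>{..<m}"
proof -
  define k where "k = n - m"
  have ls: "ls (head_word n (m, b)) = (\<Sum>i<n. head_word n (m, b) ! i - 1)"
    using ls_rgf head_word_avoids[OF assms] by simp
  show ?thesis
  proof (cases b)
    case True
    then have n: "n = k + m" using assms unfolding k_def indices_def by auto
    \<comment> \<open>Truncated subtraction gives \<open>0\<close> on the initial ones; writing
      \<open>n\<close> as \<open>k + m\<close> permits induction on \<open>m\<close>.\<close>
    have "(\<Sum>i<n. head_word n (m, b) ! i - 1) = (\<Sum>i<k + m. i - k)"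
      using True by (intro sum.cong) (auto simp: n simp del: upt_Suc)
    also have "\<dots> = \<Sum>{..<m}" by (induction m) auto
    finally show ?thesis using ls by simp
  next
    case False
    then have "2 \<le> m" "m < n" using assms unfolding indices_def by auto
    then obtain r where m: "m = Suc r" and n: "n = Suc (k + r)"
      unfolding k_def by (cases m) auto
    have "(\<Sum>i<n. head_word n (m, b) ! i - 1) =
        (\<Sum>i<Suc (k + r). if i = k + r then 0 else Suc i - k)"
      using False by (intro sum.cong) (auto simp: n m simp del: upt_Suc)
    also have "\<dots> = (\<Sum>i<k + r. Suc i - k)" by simp
    also have "\<dots> = \<Sum>{..<m}" unfolding m by (induction r) auto
    finally show ?thesis using ls by simp
  qed
qed

text \<open>At index \<open>i < m\<close> the larger letters to the right are \<open>i + 2\<close>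
  to \<open>m\<close>. From index \<open>m\<close> on the word is constant, and
  \<open>m - Suc i\<close> truncates to \<open>0\<close>.\<close>

lemma rb_tail_word:
  assumes "(m, b) \<in> indices n"
  shows "rb (tail_word n (m, b)) = \<Sum>{..<m}"
proof -
  let ?w = "tail_word n (m, b)"
  have len: "length ?w = n" by simp
  have m: "1 \<le> m" "m \<le> n" using assms unfolding indices_def by auto
  then obtain d where n: "n = m + d" using le_Suc_ex by blast
  have "card {?w ! j |j. i < j \<and> j < n \<and> ?w ! j > ?w ! i} = m - Suc i" if "i < n" for i
  proof -
    have "{?w ! j |j. i < j \<and> j < n \<and> ?w ! j > ?w ! i} = {Suc (Suc i)..m}"
    proof
      show "{?w ! j |j. i < j \<and> j < n \<and> ?w ! j > ?w ! i} \<subseteq> {Suc (Suc i)..m}"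
        using that by (auto split: if_splits)
      show "{Suc (Suc i)..m} \<subseteq> {?w ! j |j. i < j \<and> j < n \<and> ?w ! j > ?w ! i}"
      proof
        fix v assume "v \<in> {Suc (Suc i)..m}"
        then show "v \<in> {?w ! j |j. i < j \<and> j < n \<and> ?w ! j > ?w ! i}"
          using m by (intro CollectI exI[of _ "v - 1"]) auto
      qed
    qed
    then show ?thesis by simp
  qed
  then have "rb ?w = (\<Sum>i<n. m - Suc i)" unfolding rb_def len by (intro sum.cong) auto
  also have "\<dots> = (\<Sum>i<m. m - Suc i)" unfolding n by (induction d) auto
  also have "\<dots> = \<Sum>{..<m}" by (rule sum.nat_diff_reindex)
  finally show ?thesis .
qed

text \<open>With \<open>True\<close> the word is weakly increasing. With \<open>False\<close> each
  of the letters \<open>2\<close> to \<open>m\<close> has exactly one smaller value to its right,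
  the trailing \<open>1\<close>.\<close>

lemma rs_tail_word:
  assumes "(m, b) \<in> indices n"
  shows "rs (tail_word n (m, b)) = (if b then 0 else m - 1)"
proof (cases b)
  case True
  then have "{tail_word n (m, b) ! j |j. i < j \<and> j < n \<and>
      tail_word n (m, b) ! j < tail_word n (m, b) ! i} = {}" if "i < n" for i
    using that by auto
  then show ?thesis using True unfolding rs_def by simp
next
  case False
  let ?w = "tail_word n (m, b)"
  have len: "length ?w = n" by simp
  have m: "2 \<le> m" "m < n" using assms False unfolding indices_def by auto
  have "card {?w ! j |j. i < j \<and> j < n \<and> ?w ! j < ?w ! i} = (if i \<in> {1..<m} then 1 else 0)"
    if "i < n" for i
  proof -
    have "{?w ! j |j. i < j \<and> j < n \<and> ?w ! j < ?w ! i} = (if i \<in> {1..<m} then {1} else {})"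
      \<comment> \<open>Index \<open>m\<close> holds the first of the trailing ones.\<close>
      using False that m by (auto intro!: exI[of _ m])
    then show ?thesis by simp
  qed
  then have "rs ?w = (\<Sum>i<n. if i \<in> {1..<m} then 1 else 0)"
    unfolding rs_def len by (intro sum.cong) auto
  also have "\<dots> = card ({..<n} \<inter> {1..<m})"
    by (simp only: sum.If_cases[OF finite_lessThan] Collect_mem_eq) simp
  also have "{..<n} \<inter> {1..<m} = {1..<m}" using m by auto
  finally show ?thesis using False by simp
qed

text \<open>With \<open>True\<close> the word is weakly increasing. With \<open>False\<close> only
  the last \<open>1\<close> has larger letters before it, namely \<open>2\<close> to
  \<open>m\<close>.\<close>

lemma lb_head_word:
  assumes "(m, b) \<in> indices n"
  shows "lb (head_word n (m, b)) = (if b then 0 else m - 1)"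
proof (cases b)
  case True
  then have "{head_word n (m, b) ! j |j. j < i \<and>
      head_word n (m, b) ! j > head_word n (m, b) ! i} = {}" if "i < n" for i
    using that by auto
  then show ?thesis using True unfolding lb_def by simp
next
  case False
  let ?w = "head_word n (m, b)"
  have m: "2 \<le> m" "m < n" using assms False unfolding indices_def by auto
  then obtain p where n: "n = Suc p" by (cases n) auto
  have len: "length ?w = Suc p" using False n by simp
  have "{?w ! j |j. j < i \<and> ?w ! j > ?w ! i} = {}" if "i < p" for i
    using that False m by (auto simp: n simp del: upt_Suc)
  moreover have "{?w ! j |j. j < p \<and> ?w ! j > ?w ! p} = {2..m}"
  proof
    show "{?w ! j |j. j < p \<and> ?w ! j > ?w ! p} \<subseteq> {2..m}"
      using False m by (auto simp: n simp del: upt_Suc)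
    show "{2..m} \<subseteq> {?w ! j |j. j < p \<and> ?w ! j > ?w ! p}"
    proof
      fix v assume "v \<in> {2..m}"
      then show "v \<in> {?w ! j |j. j < p \<and> ?w ! j > ?w ! p}"
        using False m by (intro CollectI exI[of _ "v + (n - m) - 2"]) (auto simp: n simp del: upt_Suc)
    qed
  qed
  ultimately have "lb ?w = card {2..m}" unfolding lb_def len by simp
  then show ?thesis using False by simp
qed

section \<open>Comparison of the two classes over one index set\<close>

lemma R_12_3_1_24_3:
  assumes "n \<ge> 1"
  shows "R n {{1,2},{3}} {{1},{2,4},{3}} = tail_word n ` indices n"
proof -
  have "partition_on {1..3::nat} {{1,2},{3}}" "partition_on {1..4::nat} {{1},{2,4},{3}}"
    by (auto simp: partition_on_def disjoint_def)
  from R_eq[OF this, of n] show ?thesis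
    using mem_tail_word_image[OF assms] tail_word_avoids by auto
qed

lemma R_1_23_13_2_4:
  assumes "n \<ge> 1"
  shows "R n {{1},{2,3}} {{1,3},{2},{4}} = head_word n ` indices n"
proof -
  have "partition_on {1..3::nat} {{1},{2,3}}" "partition_on {1..4::nat} {{1,3},{2},{4}}"
    by (auto simp: partition_on_def disjoint_def)
  from R_eq[OF this, of n] show ?thesis
    using mem_head_word_image[OF assms] head_word_avoids by auto
qed

text \<open>The triangular sums increase strictly from \<open>m = 1\<close> on and so determine
  \<open>m\<close>; \<open>False\<close> occurs only with \<open>2 <= m\<close>, where
  \<open>m - 1\<close> is nonzero and reveals the flag.\<close>

lemma inj_on_statistics:
  "inj_on (\<lambda>(m, b). (\<Sum>{..<m}, if b then 0 else m - 1)) (indices n)"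
proof -
  have less: "\<Sum>{..<m} < \<Sum>{..<m'}" if "1 \<le> m" "m < m'" for m m' :: nat
  proof -
    have "\<Sum>{..<m} < \<Sum>{..<Suc m}" using that by simp
    also have "\<dots> \<le> \<Sum>{..<m'}" using that by (intro sum_mono2) auto
    finally show ?thesis .
  qed
  then have eq: "m = m'" if "\<Sum>{..<m} = \<Sum>{..<m'}" "1 \<le> m" "1 \<le> m'" for m m' :: nat
    using that by (metis less_irrefl linorder_neqE_nat)
  show ?thesis
  proof (rule inj_onI, clarify)
    fix m b m' b'
    assume x: "(m, b) \<in> indices n" "(m', b') \<in> indices n"
      and s: "\<Sum>{..<m} = \<Sum>{..<m'}" "(if b then 0 else m - 1) = (if b' then 0 else m' - 1)"
    have "m = m'" using eq[OF s(1)] x unfolding indices_def by auto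
    moreover have "b = b'" using s(2) x \<open>m = m'\<close> unfolding indices_def by (cases b; cases b') auto
    ultimately show "m = m' \<and> b = b'" ..
  qed
qed

text \<open>Distinct indices already give distinct pairs of statistics, so the word map cannot
  identify them.\<close>

lemma inj_on_tail_word: "inj_on (tail_word n) (indices n)"
proof (rule inj_on_imageI2)
  have "((\<lambda>w. (rb w, rs w)) \<circ> tail_word n) x =
      (\<lambda>(m, b). (\<Sum>{..<m}, if b then 0 else m - 1)) x" if "x \<in> indices n" for x
    using that by (cases x) (simp only: rb_tail_word rs_tail_word o_apply case_prod_conv)
  then show "inj_on ((\<lambda>w. (rb w, rs w)) \<circ> tail_word n) (indices n)"
    using inj_on_statistics by (subst inj_on_cong)
qed

lemma inj_on_head_word: "inj_on (head_word n) (indices n)"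
proof (rule inj_on_imageI2)
  have "((\<lambda>w. (ls w, lb w)) \<circ> head_word n) x =
      (\<lambda>(m, b). (\<Sum>{..<m}, if b then 0 else m - 1)) x" if "x \<in> indices n" for x
    using that by (cases x) (simp only: ls_head_word lb_head_word o_apply case_prod_conv)
  then show "inj_on ((\<lambda>w. (ls w, lb w)) \<circ> head_word n) (indices n)"
    using inj_on_statistics by (subst inj_on_cong)
qed

text \<open>Turns the counting of words in either class into the counting of indices.\<close>

lemma card_filter_image:
  assumes "inj_on g A"
  shows "card {w \<in> g ` A. P w} = card {x \<in> A. P (g x)}"
proof -
  have "{w \<in> g ` A. P w} = g ` {x \<in> A. P (g x)}" by auto
  then show ?thesis using assms by (simp add: card_image inj_on_subset)
qed

theorem theorem8p1:
  fixes n :: nat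
  assumes "n \<ge> 1"
  shows "(\<forall>k::int.
            card {w \<in> R n {{1,2},{3}} {{1},{2,4},{3}}. int (rb w) = k} =
            card {w \<in> R n {{1},{2,3}} {{1,3},{2},{4}}. int (ls w) = k}) \<and>
         (\<forall>k::int.
            card {w \<in> R n {{1,2},{3}} {{1},{2,4},{3}}. int (rs w) = k} =
            card {w \<in> R n {{1},{2,3}} {{1,3},{2},{4}}. int (lb w) = k})"
proof -
  have "rb (tail_word n x) = ls (head_word n x)" "rs (tail_word n x) = lb (head_word n x)"
    if "x \<in> indices n" for x
    using that rb_tail_word ls_head_word rs_tail_word lb_head_word by (cases x; metis)+
  \<comment> \<open>After reindexing, both sides of each equation count the same elements of
    \<open>indices n\<close>.\<close>
  then show ?thesis
    unfolding R_12_3_1_24_3[OF assms] R_1_23_13_2_4[OF assms]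
      card_filter_image[OF inj_on_tail_word] card_filter_image[OF inj_on_head_word]
    by (auto cong: conj_cong)
qed

end
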